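(* For any trees $T_1$ and $T_2$ of order $m$, every connected cograph $G$ with $\delta(G)\ge \kappa(G)+m-1$ contains subtrees $T'_1\cong T_1$ and $T'_2\cong T_2$ with $V(T'_1)\cap V(T'_2)=\emptyset$ such that $\kappa\bigl(G-(E(T'_1)\cup E(T'_2))\bigr)=\kappa(G)$.
   Context: Graphs are simple and undirected. The order of a graph is its number of vertices; $\delta(G)$ is the minimum degree of $G$. Cographs are defined recursively: $K_1$ is a cograph; the disjoint union of cographs is a cograph; the join of cographs is a cograph, where the join $G_1+G_2$ of vertex-disjoint graphs is obtained from their disjoint union by adding all edges between $V(G_1)$ and $V(G_2)$. (Equivalently, cographs are the graphs with no induced path $P_4$ on four vertices.) The connectivity $\kappa(G)$ is the minimum number of vertices whose removal from $G$ results in a disconnected graph or a trivial graph (a graph of order 1); in particular $\kappa(K_1)=0$, although $K_1$ is connected. For $F\subseteq E(G)$, $G-F$ is the graph obtained by deleting all edges of $F$ (keeping all vertices). A subtree of $G$ is a (not necessarily induced) subgraph that is a tree.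
   Formalization: The cograph G is additionally assumed to have order at least 2, because for G = K_1 and m = 1 the degree condition holds (0 ≥ 0) but K_1 contains no two vertex-disjoint subtrees; no other case is excluded. *)

theory Defs
  imports "Graph_Theory.Graph_Theory"
begin

text \<open>
  A finite simple undirected graph is a \<open>pair_graph\<close>: a finite, loop-free, symmetric set of
  pairs over a finite vertex set. The edge \<open>{u, v}\<close> is the pair of arcs \<open>(u, v)\<close>, \<open>(v, u)\<close>,
  so a set of edges is a symmetric set of arcs.
\<close>

definition disjoint_union ::
  "'a pair_pre_digraph \<Rightarrow> 'a pair_pre_digraph \<Rightarrow> 'a pair_pre_digraph" where
  "disjoint_union G H = \<lparr> pverts = pverts G \<union> pverts H, parcs = parcs G \<union> parcs H \<rparr>"

definition graph_join ::
  "'a pair_pre_digraph \<Rightarrow> 'a pair_pre_digraph \<Rightarrow> 'a pair_pre_digraph" where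
  "graph_join G H = \<lparr> pverts = pverts G \<union> pverts H,
     parcs = parcs G \<union> parcs H \<union> pverts G \<times> pverts H \<union> pverts H \<times> pverts G \<rparr>"

inductive cograph :: "'a pair_pre_digraph \<Rightarrow> bool" where
  cograph_K1: "cograph \<lparr> pverts = {v}, parcs = {} \<rparr>"
| cograph_union: "\<lbrakk> cograph G; cograph H; pverts G \<inter> pverts H = {} \<rbrakk>
    \<Longrightarrow> cograph (disjoint_union G H)"
| cograph_join: "\<lbrakk> cograph G; cograph H; pverts G \<inter> pverts H = {} \<rbrakk>
    \<Longrightarrow> cograph (graph_join G H)"

lemma cograph_imp_pair_graph:
  assumes "cograph G"
  shows "pair_graph G"
proof -
  have "pverts G \<noteq> {} \<and> finite (pverts G) \<and> parcs G \<subseteq> pverts G \<times> pverts G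
      \<and> sym (parcs G) \<and> irrefl (parcs G)"
    using assms
    by induction (auto simp: disjoint_union_def graph_join_def sym_def irrefl_def)
  then show ?thesis
    by unfold_locales
      (auto simp: symmetric_def irrefl_def intro: finite_subset[of _ "pverts G \<times> pverts G"])
qed

text \<open>
  In a symmetric digraph every arc yields the closed walk \<open>u, v, u\<close>, which the library counts
  as a \<open>cycle\<close>; so its \<open>tree\<close> is not the undirected notion. The cycles of a
  simple graph are those of length at least 3.
\<close>

definition graph_tree :: "'a pair_pre_digraph \<Rightarrow> bool" where
  "graph_tree T \<longleftrightarrow> pair_graph T \<and> connected (with_proj T)
     \<and> \<not> (\<exists>p. pre_digraph.cycle (with_proj T) p \<and> 3 \<le> length p)"

definition subtree :: "'a pair_pre_digraph \<Rightarrow> 'a pair_pre_digraph \<Rightarrow> bool" where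
  "subtree T G \<longleftrightarrow> graph_tree T \<and> subgraph (with_proj T) (with_proj G)"

definition del_edges :: "'a pair_pre_digraph \<Rightarrow> 'a rel \<Rightarrow> 'a pair_pre_digraph" where
  "del_edges G F = \<lparr> pverts = pverts G, parcs = parcs G - F \<rparr>"

text \<open>Arcs are symmetric, so the degree of a vertex is its out-degree.\<close>

definition min_degree :: "'a pair_pre_digraph \<Rightarrow> nat" where
  "min_degree G = Min (out_degree (with_proj G) ` pverts G)"

text \<open>
  The removed set is a proper subset of the vertices because the library regards the graph
  without vertices as not connected. A proper subset is always available that leaves one
  vertex, so the minimum exists for every nonempty finite graph.
\<close>

definition connectivity :: "'a pair_pre_digraph \<Rightarrow> nat" where
  "connectivity G = (LEAST k. \<exists>S. S \<subset> pverts G \<and> card S = k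
     \<and> (\<not> connected (with_proj G \<restriction> (pverts G - S)) \<or> card (pverts G - S) = 1))"

text \<open>
  For \<open>K\<^sub>1\<close> both \<open>min_degree\<close> and \<open>connectivity\<close> are 0, so a condition
  \<open>min_degree G \<ge> connectivity G + m - 1\<close> admits it exactly when \<open>m = 1\<close>; since it contains no
  two disjoint subtrees, it has to be excluded from statements asserting that two exist.
\<close>

end

theory Submission
  imports Defs
begin

text \<open>
  A cograph has no induced path on four vertices. If a minimum vertex cut \<open>S\<close> disconnects the graph,
  every \<open>s \<in> S\<close> has neighbours in several components of \<open>W = V - S\<close>, so a non-neighbour of \<open>s\<close> in
  \<open>W\<close> would yield such a path; hence \<open>S\<close> is completely joined to \<open>W\<close>. Split \<open>W\<close> into two
  nonempty parts without arcs between them. Every vertex of \<open>W\<close> keeps at least \<open>m - 1\<close> neighbours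
  in its own part, so the two trees embed greedily, one into each part. Deleting their
  edges leaves the complete join between \<open>S\<close> and \<open>W\<close> intact, so fewer than \<open>card S\<close> vertices still
  do not disconnect the graph. If no minimum vertex cut disconnects it, the degree condition forces
  \<open>m \<le> 1\<close> and no edge is deleted at all.
\<close>

section \<open>Connectedness read off the arc relation\<close>

text \<open>For symmetric \<open>E\<close> this is connectedness of the graph on \<open>W\<close>,
  put in terms of cuts instead of walks: its failure hands over a separation of \<open>W\<close>,
  and arcs can be deleted from \<open>E\<close> without building a new graph.\<close>

definition linked :: "'a rel \<Rightarrow> 'a set \<Rightarrow> bool" where
  "linked E W \<longleftrightarrow> W \<noteq> {} \<and> (\<forall>X. X \<subset> W \<longrightarrow> X \<noteq> {} \<longrightarrow> (\<exists>x\<in>X. \<exists>y\<in>W - X. (x, y) \<in> E))"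

lemma linkedD:
  assumes "linked E W" "X \<subseteq> W" "a \<in> X" "b \<in> W" "b \<notin> X"
  obtains x y where "x \<in> X" "y \<in> W" "y \<notin> X" "(x, y) \<in> E"
proof -
  have "X \<subset> W" "X \<noteq> {}" using assms by auto
  then show ?thesis using assms(1) that unfolding linked_def by blast
qed

text \<open>A walk cannot get out of a set that no arc leaves; conversely, no arc leaves the set of
  vertices reachable from \<open>u\<close>, so it is all of \<open>W\<close>. By symmetry
  \<open>mk_symmetric\<close> adds no arcs.\<close>

lemma connected_induce_iff_linked:
  assumes "sym (parcs G)"
  shows "connected (with_proj G \<restriction> W) \<longleftrightarrow> linked (parcs G) W"
proof -
  let ?R = "Restr (parcs G) W"
  have *: "parcs (mk_symmetric (with_proj G \<restriction> W)) = ?R"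
    using assms by (auto simp: mk_symmetric_def sym_def)
  have **: "pverts (mk_symmetric (with_proj G \<restriction> W)) = W"
    by (simp add: mk_symmetric_def)
  have "connected (with_proj G \<restriction> W) \<longleftrightarrow> W \<noteq> {} \<and> (\<forall>u\<in>W. \<forall>v\<in>W. (u, v) \<in> rtrancl_on W ?R)"
    by (simp add: connected_def strongly_connected_def reachable_def * **)
  also have "\<dots> \<longleftrightarrow> linked (parcs G) W"
  proof
    assume L: "W \<noteq> {} \<and> (\<forall>u\<in>W. \<forall>v\<in>W. (u, v) \<in> rtrancl_on W ?R)"
    have "\<exists>x\<in>X. \<exists>y\<in>W - X. (x, y) \<in> parcs G" if X: "X \<subset> W" "X \<noteq> {}" for X
    proof (rule ccontr)
      assume no: "\<not> ?thesis"
      obtain x y where xy: "x \<in> X" "y \<in> W" "y \<notin> X" using X by auto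
      have "(x, y) \<in> rtrancl_on W ?R" using L X xy by auto
      then have "y \<in> X" by (induction rule: rtrancl_on_induct) (use no xy in auto)
      then show False using xy by simp
    qed
    then show "linked (parcs G) W" using L unfolding linked_def by simp
  next
    assume R: "linked (parcs G) W"
    have "(u, v) \<in> rtrancl_on W ?R" if uv: "u \<in> W" "v \<in> W" for u v
    proof (rule ccontr)
      let ?X = "{w \<in> W. (u, w) \<in> rtrancl_on W ?R}"
      assume no: "(u, v) \<notin> rtrancl_on W ?R"
      have "u \<in> ?X" using uv by auto
      then obtain x y where "x \<in> ?X" "y \<in> W" "y \<notin> ?X" "(x, y) \<in> parcs G"
        using linkedD[OF R, of ?X u v] uv no by blast
      moreover from this have "(u, y) \<in> rtrancl_on W ?R"
        by (auto intro: rtrancl_on_into_rtrancl_on)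
      ultimately show False by simp
    qed
    then show "W \<noteq> {} \<and> (\<forall>u\<in>W. \<forall>v\<in>W. (u, v) \<in> rtrancl_on W ?R)"
      using R by (simp add: linked_def)
  qed
  finally show ?thesis .
qed

lemma induce_pverts:
  assumes "pair_wf_digraph G"
  shows "with_proj G \<restriction> pverts G = with_proj G"
proof -
  interpret pair_wf_digraph G by fact
  show ?thesis by (auto simp: induce_subgraph_def with_proj_def intro: in_arcsD1 in_arcsD2)
qed

lemma pair_graph_sym: "pair_graph G \<Longrightarrow> sym (parcs G)"
proof -
  assume "pair_graph G"
  then interpret pair_graph G .
  show ?thesis by (auto simp: sym_def intro: arcs_symmetric)
qed

section \<open>Greedy embedding of trees\<close>

lemma linked_insert:
  assumes "sym E" "linked E A" "a \<in> A" "(a, b) \<in> E"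
  shows "linked E (insert b A)"
  unfolding linked_def
proof (intro conjI allI impI)
  fix X assume X: "X \<subset> insert b A" "X \<noteq> {}"
  show "\<exists>x\<in>X. \<exists>y\<in>insert b A - X. (x, y) \<in> E"
  proof (cases "X \<inter> A = {}")
    case True
    then have "X = {b}" "b \<notin> A" using X by auto
    then show ?thesis using assms by (auto simp: sym_def)
  next
    case False
    then obtain c where c: "c \<in> X \<inter> A" by auto
    show ?thesis
    proof (cases "A \<subseteq> X")
      case True
      then have "b \<notin> X" using X by auto
      then show ?thesis using True assms by auto
    next
      case False
      then obtain d where "d \<in> A" "d \<notin> X \<inter> A" by auto
      then show ?thesis using c linkedD[OF assms(2), of "X \<inter> A" c d] by blast
    qed
  qed
qed simp

text \<open>Two arcs between \<open>b\<close> and \<open>A\<close> would close up with a path inside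
  \<open>A\<close> to form a cycle. Hence a vertex attached to a connected part of a tree brings
  only one arc to respect.\<close>

lemma graph_tree_unique_neighbour:
  assumes "graph_tree T" "A \<subseteq> pverts T" "linked (parcs T) A" "b \<notin> A"
    and "a \<in> A" "(a, b) \<in> parcs T" "a' \<in> A" "(a', b) \<in> parcs T"
  shows "a' = a"
proof (rule ccontr)
  assume ne: "a' \<noteq> a"
  have pg: "pair_graph T" using assms(1) by (simp add: graph_tree_def)
  interpret pair_graph T by (fact pg)
  \<comment> \<open>The path from \<open>a\<close> to \<open>a'\<close> is taken in the induced
    subgraph on \<open>A\<close>, so it avoids \<open>b\<close>.\<close>
  let ?H = "with_proj T \<restriction> A"
  interpret H: wf_digraph ?H by (rule wellformed_induce_subgraph)
  have sub: "subgraph ?H (with_proj T)"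
    by (intro induced_imp_subgraph induced_induce) (use assms in auto)
  have "connected ?H" using assms pair_graph_sym[OF pg] by (simp add: connected_induce_iff_linked)
  moreover have "mk_symmetric ?H = \<lparr>pverts = A, parcs = Restr (parcs T) A\<rparr>"
    using pair_graph_sym[OF pg] by (auto simp: mk_symmetric_def sym_def)
  moreover have "arcs_ends ?H = Restr (parcs T) A"
    by (auto simp: arcs_ends_conv)
  ultimately have "a \<rightarrow>\<^sup>*\<^bsub>?H\<^esub> a'"
    using assms by (auto simp: connected_def strongly_connected_def reachable_def)
  then obtain p where p: "H.apath a p a'" by (auto simp: H.reachable_apath)
  have aw: "awalk a p a'" using p sub by (auto simp: H.apath_def intro: subgraph_awalk_imp_awalk)
  have pvH: "H.awalk_verts a p = awalk_verts a p"
    by (simp add: compatible_awalk_verts[OF compatible_induce_subgraph])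
  have set: "set (awalk_verts a p) \<subseteq> A"
    using p H.awalk_verts_in_verts[of a p] unfolding pvH by (auto simp: H.apath_def H.awalk_def)
  have dist: "distinct (awalk_verts a p)"
    using p pvH by (simp add: H.apath_def)
  have "p \<noteq> []" using aw ne by (auto simp: awalk_simps)
  \<comment> \<open>As \<open>a\<close> and \<open>a'\<close> differ, \<open>p\<close> has an arc;
    with the two arcs at \<open>b\<close> the cycle reaches length 3, which
    \<open>graph_tree\<close> forbids.\<close>
  let ?c = "(b, a) # p @ [(a', b)]"
  have arcs: "(b, a) \<in> parcs T" "(a', b) \<in> parcs T" using assms arcs_symmetric by auto
  have w: "awalk a (p @ [(a', b)]) b"
    using aw arcs in_arcsD1[OF arcs(1)] by (auto intro!: awalk_appendI simp: awalk_simps)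
  have "awalk b ?c b"
    using w arcs by (auto simp: awalk_Cons_iff simp del: awalk_append_iff)
  moreover have "tl (awalk_verts b ?c) = awalk_verts a p @ [b]"
    using awalk_verts_append[OF w] by simp
  moreover have "distinct (awalk_verts a p @ [b])" using dist set assms by auto
  moreover have "3 \<le> length ?c" using \<open>p \<noteq> []\<close> by (cases p) auto
  ultimately have "cycle ?c \<and> 3 \<le> length ?c" by (auto simp: cycle_def)
  then show False using assms(1) by (auto simp: graph_tree_def)
qed

text \<open>A connected part of \<open>T\<close> is embedded and enlarged by one vertex at a time;
  the degree bound inside \<open>C\<close> always leaves a free neighbour for the next
  vertex.\<close>

lemma graph_tree_embedding:
  assumes T: "graph_tree T"
    and E: "sym E" "irrefl E" and C: "finite C" "C \<noteq> {}"
    and deg: "\<And>x. x \<in> C \<Longrightarrow> card (pverts T) \<le> Suc (card {y \<in> C. (x, y) \<in> E})"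
  obtains f where "inj_on f (pverts T)" "f ` pverts T \<subseteq> C"
    "\<And>a b. (a, b) \<in> parcs T \<Longrightarrow> (f a, f b) \<in> E"
proof -
  have pg: "pair_graph T" using T by (simp add: graph_tree_def)
  interpret pair_graph T by (fact pg)
  have symT: "sym (parcs T)" by (rule pair_graph_sym) fact
  have lT: "linked (parcs T) (pverts T)"
    using T connected_induce_iff_linked[OF symT, of "pverts T"] induce_pverts[OF pair_wf_digraph]
    by (auto simp: graph_tree_def)
  \<comment> \<open>A partial embedding. Connectedness of the domain \<open>A\<close> is carried
    along because the unique neighbour argument rests on it.\<close>
  define good where "good A f \<longleftrightarrow> A \<subseteq> pverts T \<and> linked (parcs T) A \<and> inj_on f A \<and> f ` A \<subseteq> C
     \<and> (\<forall>a\<in>A. \<forall>b\<in>A. (a, b) \<in> parcs T \<longrightarrow> (f a, f b) \<in> E)" for A f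
  have "\<exists>A f. card A = Suc n \<and> good A f" if "Suc n \<le> card (pverts T)" for n
    using that
  proof (induction n)
    case 0
    obtain r where r: "r \<in> pverts T" using lT by (auto simp: linked_def)
    obtain c where "c \<in> C" using C by auto
    then have "good {r} (\<lambda>_. c)"
      using r no_loops' by (auto simp: good_def linked_def)
    then show ?case by (intro exI[of _ "{r}"] exI) auto
  next
    case (Suc n)
    then obtain A f where A: "card A = Suc n" and g: "good A f" by auto
    have "A \<noteq> pverts T" using A Suc.prems by auto
    moreover have "A \<subseteq> pverts T" "A \<noteq> {}" using g A by (auto simp: good_def)
    ultimately obtain a b where ab: "a \<in> A" "b \<in> pverts T" "b \<notin> A" "(a, b) \<in> parcs T"
      using lT unfolding linked_def by blast
    have finA: "finite A" using A by (metis card.infinite nat.distinct(1))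
    \<comment> \<open>\<open>A\<close> has \<open>Suc n\<close> vertices, and \<open>f a\<close> is
      not its own neighbour, so at most \<open>n\<close> neighbours of \<open>f a\<close> are
      occupied, while \<open>deg\<close> provides at least \<open>Suc n\<close>.\<close>
    have "f ` A \<inter> {y \<in> C. (f a, y) \<in> E} \<subset> {y \<in> C. (f a, y) \<in> E}" (is "_ \<subset> ?N")
    proof (rule ccontr)
      assume "\<not> ?thesis"
      then have N: "?N \<subseteq> f ` A" by auto
      have "?N \<subseteq> f ` A - {f a}" using N E by (auto simp: irrefl_def)
      then have "card ?N \<le> card (f ` A - {f a})" using finA by (intro card_mono) auto
      also have "\<dots> \<le> n" using A ab finA card_image_le[OF finA, of f]
        by (simp add: card_Diff_singleton)
      finally show False using deg[of "f a"] g ab Suc.prems by (auto simp: good_def)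
    qed
    then obtain y where y: "y \<in> C" "(f a, y) \<in> E" "y \<notin> f ` A" by auto
    \<comment> \<open>The arcs between \<open>a\<close> and \<open>b\<close> are the only new ones,
      so any free neighbour \<open>y\<close> of \<open>f a\<close> can serve as the image of
      \<open>b\<close>.\<close>
    have only: "a' = a" if "a' \<in> A" "(a', b) \<in> parcs T \<or> (b, a') \<in> parcs T" for a'
      using graph_tree_unique_neighbour[OF T, of A b a a'] g ab that arcs_symmetric
      by (auto simp: good_def)
    have "((f(b := y)) c, (f(b := y)) d) \<in> E"
      if cd: "c \<in> insert b A" "d \<in> insert b A" "(c, d) \<in> parcs T" for c d
    proof -
      consider "c = b" "d = b" | "c = b" "d \<in> A" "d \<noteq> b" | "c \<in> A" "c \<noteq> b" "d = b"
        | "c \<in> A" "d \<in> A" "c \<noteq> b" "d \<noteq> b" using cd ab by blast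
      then show ?thesis
      proof cases
        case 1
        then show ?thesis using cd no_loops' by auto
      next
        case 2
        then have "d = a" using only cd by auto
        then show ?thesis using 2 y E by (auto simp: sym_def)
      next
        case 3
        then have "c = a" using only cd by auto
        then show ?thesis using 3 y by auto
      next
        case 4
        then show ?thesis using g cd by (auto simp: good_def)
      qed
    qed
    moreover have "inj_on (f(b := y)) (insert b A)"
      using g ab y by (auto simp: good_def inj_on_def)
    moreover have "(f(b := y)) ` insert b A \<subseteq> C" using g y by (auto simp: good_def)
    moreover have "linked (parcs T) (insert b A)"
      using linked_insert[OF symT] ab g by (auto simp: good_def)
    ultimately have "good (insert b A) (f(b := y))"
      using g ab unfolding good_def by blast
    moreover have "card (insert b A) = Suc (Suc n)" using A ab finA by simp
    ultimately show ?case by blast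
  qed
  moreover obtain n where n: "card (pverts T) = Suc n"
    using lT by (metis card_eq_0_iff linked_def not0_implies_Suc pair_finite_verts)
  ultimately obtain A f where "card A = card (pverts T)" and g: "good A f" by force
  then have "A = pverts T" by (intro card_subset_eq) (auto simp: good_def)
  then show ?thesis using g that by (auto simp: good_def in_arcsD1 in_arcsD2)
qed

section \<open>Copies of trees inside a host graph\<close>

lemma (in wf_digraph) cycle_app_isoI:
  assumes "cycle p" and hom: "digraph_isomorphism hom"
  shows "pre_digraph.cycle (app_iso hom G) (map (iso_arcs hom) p)"
proof -
  obtain u where u: "awalk u p u" "distinct (tl (awalk_verts u p))" "p \<noteq> []"
    using assms(1) by (auto simp: cycle_def)
  have "set (tl (awalk_verts u p)) \<subseteq> verts G"
    using u(1) awalk_verts_non_Nil[of u p] by (blast elim: awalkE dest: list.set_sel(2)[rotated])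
  then have "distinct (map (iso_verts hom) (tl (awalk_verts u p)))"
    using u(2) digraph_isomorphism_inj_on_verts[OF hom]
    by (auto simp: distinct_map intro: inj_on_subset)
  then have "distinct (tl (map (iso_verts hom) (awalk_verts u p)))" by (simp add: map_tl)
  then show ?thesis
    using awalk_app_isoI[OF u(1) hom] u awalk_verts_app_iso_eq[OF hom u(1)]
    unfolding pre_digraph.cycle_def by (metis map_is_Nil_conv)
qed

definition image_graph :: "('b \<Rightarrow> 'a) \<Rightarrow> 'b pair_pre_digraph \<Rightarrow> 'a pair_pre_digraph" where
  "image_graph f T = \<lparr>pverts = f ` pverts T, parcs = map_prod f f ` parcs T\<rparr>"

text \<open>The inverse isomorphism serves twice: it gives \<open>digraph_iso\<close> in the
  required direction, and it pulls a cycle of the copy back to one of the same length in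
  \<open>T\<close>.\<close>

lemma graph_tree_image_graph:
  assumes T: "graph_tree T" and f: "inj_on f (pverts T)"
  shows "graph_tree (image_graph f T)"
    and "digraph_iso (with_proj (image_graph f T)) (with_proj T)"
proof -
  interpret pair_graph T using T by (simp add: graph_tree_def)
  define h where "h = \<lparr>iso_verts = f, iso_arcs = map_prod f f, iso_head = snd, iso_tail = fst\<rparr>"
  have "inj_on (map_prod f f) (pverts T \<times> pverts T)" using f by (auto simp: inj_on_def)
  then have "inj_on (map_prod f f) (parcs T)"
    by (rule inj_on_subset) (auto intro: in_arcsD1 in_arcsD2)
  then have h: "digraph_isomorphism h"
    using f wf_digraph_wp_iff pair_wf_digraph by (auto simp: digraph_isomorphism_def h_def)
  have app: "with_proj (image_graph f T) = app_iso h (with_proj T)"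
    by (auto simp: app_iso_def h_def image_graph_def with_proj_def)
  have inv: "app_iso (inv_iso h) (app_iso h (with_proj T)) = with_proj T"
    using h by simp
  have iso: "pre_digraph.digraph_isomorphism (app_iso h (with_proj T)) (inv_iso h)"
    using h by (rule digraph_isomorphism_invI)
  then show "digraph_iso (with_proj (image_graph f T)) (with_proj T)"
    unfolding digraph_iso_def app using inv by metis
  have "pair_graph (image_graph f T)"
  proof
    show "finite (pverts (image_graph f T))" "finite (parcs (image_graph f T))"
      by (auto simp: image_graph_def)
    show "fst e \<in> pverts (image_graph f T)" "snd e \<in> pverts (image_graph f T)"
      if "e \<in> parcs (image_graph f T)" for e
      using that by (auto simp: image_graph_def intro: in_arcsD1 in_arcsD2)
    show "fst e \<noteq> snd e" if e: "e \<in> parcs (image_graph f T)" for e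
    proof -
      obtain a b where ab: "(a, b) \<in> parcs T" "e = (f a, f b)" using e by (auto simp: image_graph_def)
      then have "a \<noteq> b" "a \<in> pverts T" "b \<in> pverts T"
        using no_loops' in_arcsD1 in_arcsD2 by blast+
      then show ?thesis using ab f by (auto simp: inj_on_def)
    qed
    show "symmetric (with_proj (image_graph f T))"
      using arcs_symmetric by (force simp: symmetric_def sym_def image_graph_def)
  qed
  moreover have "connected (with_proj (image_graph f T))"
    using T connectedI_app_iso[OF _ h] by (simp add: graph_tree_def app)
  moreover have "\<not> (\<exists>p. pre_digraph.cycle (with_proj (image_graph f T)) p \<and> 3 \<le> length p)"
  proof
    assume "\<exists>p. pre_digraph.cycle (with_proj (image_graph f T)) p \<and> 3 \<le> length p"
    then obtain p where "pre_digraph.cycle (app_iso h (with_proj T)) p" "3 \<le> length p"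
      by (auto simp: app)
    then have "cycle (map (iso_arcs (inv_iso h)) p)" "3 \<le> length (map (iso_arcs (inv_iso h)) p)"
      using wf_digraph.cycle_app_isoI[OF wf_digraphI_app_iso[OF h] _ iso] unfolding inv by auto
    then show False using T unfolding graph_tree_def by blast
  qed
  ultimately show "graph_tree (image_graph f T)" by (simp add: graph_tree_def)
qed

lemma subtree_within:
  assumes T: "graph_tree T" and G: "pair_graph G" and C: "C \<subseteq> pverts G" "C \<noteq> {}"
    and deg: "\<And>x. x \<in> C \<Longrightarrow> card (pverts T) \<le> Suc (card {y \<in> C. (x, y) \<in> parcs G})"
  obtains T' where "subtree T' G" "digraph_iso (with_proj T') (with_proj T)" "pverts T' \<subseteq> C"
proof -
  interpret pair_graph G by fact
  have "irrefl (parcs G)" "finite C" using no_loops' C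
    by (auto simp: irrefl_def intro: finite_subset)
  then obtain f where f: "inj_on f (pverts T)" "f ` pverts T \<subseteq> C"
    "\<And>a b. (a, b) \<in> parcs T \<Longrightarrow> (f a, f b) \<in> parcs G"
    using graph_tree_embedding[OF T pair_graph_sym[OF G] _ _ C(2) deg] by metis
  note image = graph_tree_image_graph[OF T f(1)]
  have "wf_digraph (with_proj (image_graph f T))"
    using image(1) by (auto simp: graph_tree_def wf_digraph_wp_iff pair_graph_def pair_digraph_def
        pair_fin_digraph_def)
  moreover have "wf_digraph (with_proj G)" ..
  ultimately have "subgraph (with_proj (image_graph f T)) (with_proj G)"
    using f(2,3) C(1) by (auto simp: subgraph_def compatible_def image_graph_def)
  then show ?thesis using image f(2) that[of "image_graph f T"]
    by (auto simp: subtree_def image_graph_def)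
qed

section \<open>Induced paths on four vertices\<close>

text \<open>In a disjoint union the three arcs hold all four vertices on one side. In a join
  nonadjacent vertices lie on the same side, and the missing arcs again chain all four together. So
  the path lies in one of the two smaller cographs.\<close>

lemma cograph_P4_free:
  assumes "cograph G" "(a, b) \<in> parcs G" "(b, c) \<in> parcs G" "(c, d) \<in> parcs G"
    and "(a, c) \<notin> parcs G" "(b, d) \<notin> parcs G" "(a, d) \<notin> parcs G"
  shows False
  using assms
proof (induction arbitrary: a b c d)
  case (cograph_K1 v)
  then show ?case by simp
next
  case (cograph_union G H)
  interpret G: pair_graph G by (rule cograph_imp_pair_graph) fact
  interpret H: pair_graph H by (rule cograph_imp_pair_graph) fact
  have "{(a, b), (b, c), (c, d)} \<subseteq> parcs G \<or> {(a, b), (b, c), (c, d)} \<subseteq> parcs H"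
    using cograph_union.prems cograph_union.hyps(3)
      G.in_arcsD1 G.in_arcsD2 H.in_arcsD1 H.in_arcsD2
    unfolding disjoint_union_def by (auto; blast)
  then show ?case
    using cograph_union.prems cograph_union.IH by (auto simp: disjoint_union_def)
next
  case (cograph_join G H)
  interpret G: pair_graph G by (rule cograph_imp_pair_graph) fact
  interpret H: pair_graph H by (rule cograph_imp_pair_graph) fact
  interpret J: pair_graph "graph_join G H"
    by (rule cograph_imp_pair_graph, rule cograph.cograph_join) fact+
  have V: "a \<in> pverts G \<union> pverts H" "b \<in> pverts G \<union> pverts H"
      "c \<in> pverts G \<union> pverts H" "d \<in> pverts G \<union> pverts H"
    using cograph_join.prems(1-3)[THEN J.in_arcsD1] cograph_join.prems(3)[THEN J.in_arcsD2]
    by (auto simp: graph_join_def)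
  have "{a, b, c, d} \<subseteq> pverts G \<or> {a, b, c, d} \<subseteq> pverts H"
    using cograph_join.prems(4-6) V by (auto simp: graph_join_def)
  then show ?case
  proof
    assume "{a, b, c, d} \<subseteq> pverts G"
    then have "{a, b, c, d} \<inter> pverts H = {}" using cograph_join.hyps(3) by blast
    then show ?case using cograph_join.prems cograph_join.IH(1)[of a b c d]
        H.in_arcsD1 H.in_arcsD2 by (auto simp: graph_join_def)
  next
    assume "{a, b, c, d} \<subseteq> pverts H"
    then have "{a, b, c, d} \<inter> pverts G = {}" using cograph_join.hyps(3) by blast
    then show ?case using cograph_join.prems cograph_join.IH(2)[of a b c d]
        G.in_arcsD1 G.in_arcsD2 by (auto simp: graph_join_def)
  qed
qed

section \<open>Minimum vertex cuts\<close>

text \<open>Leaving a single vertex counts as a cut, which covers complete graphs, where no removal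
  disconnects.\<close>

definition vertex_cut :: "'a pair_pre_digraph \<Rightarrow> 'a set \<Rightarrow> bool" where
  "vertex_cut G S \<longleftrightarrow> S \<subset> pverts G
     \<and> (\<not> linked (parcs G) (pverts G - S) \<or> card (pverts G - S) = 1)"

lemma connectivity_vertex_cut:
  assumes "sym (parcs G)"
  shows "connectivity G = (LEAST k. \<exists>S. vertex_cut G S \<and> card S = k)"
  unfolding connectivity_def vertex_cut_def connected_induce_iff_linked[OF assms]
  by (rule arg_cong[where f = Least]) auto

lemma connectivity_le:
  assumes "sym (parcs G)" "vertex_cut G S"
  shows "connectivity G \<le> card S"
  unfolding connectivity_vertex_cut[OF assms(1)] by (rule Least_le) (use assms in auto)

lemma obtain_minimum_vertex_cut:
  assumes "sym (parcs G)" "pverts G \<noteq> {}"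
  obtains S where "vertex_cut G S" "card S = connectivity G"
proof -
  obtain v where "v \<in> pverts G" using assms by auto
  then have "pverts G - (pverts G - {v}) = {v}" by auto
  then have "vertex_cut G (pverts G - {v})"
    using \<open>v \<in> pverts G\<close> by (auto simp: vertex_cut_def)
  then have "\<exists>k S. vertex_cut G S \<and> card S = k" by auto
  from LeastI_ex[OF this] show ?thesis
    using that unfolding connectivity_vertex_cut[OF assms(1)] by auto
qed

text \<open>If \<open>s\<close> missed \<open>x\<close>, some arc \<open>(p, q)\<close> in the
  component of \<open>x\<close> would lead from a non-neighbour to a neighbour of \<open>s\<close>.
  With a neighbour \<open>b\<close> of \<open>s\<close> in another component, \<open>p\<close>,
  \<open>q\<close>, \<open>s\<close>, \<open>b\<close> is an induced path.\<close>

lemma cograph_minimum_cut_complete: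
  assumes G: "cograph G" and S: "S \<subset> pverts G" "\<not> linked (parcs G) (pverts G - S)"
    and min: "card S = connectivity G"
    and s: "s \<in> S" and x: "x \<in> pverts G - S"
  shows "(s, x) \<in> parcs G"
proof (rule ccontr)
  assume sx: "(s, x) \<notin> parcs G"
  define E W where "E = parcs G" and "W = pverts G - S"
  have pg: "pair_graph G" using G by (rule cograph_imp_pair_graph)
  interpret pair_graph G by (fact pg)
  have sym: "sym E" unfolding E_def by (rule pair_graph_sym) fact
  note symD = symD[OF sym]
  \<comment> \<open>\<open>B\<close> is the side of a separation of \<open>W\<close> that contains
    \<open>x\<close>; it ensures that the component of \<open>x\<close> is not all of
    \<open>W\<close>.\<close>
  obtain B where B: "x \<in> B" "B \<subset> W" "\<And>a y. a \<in> B \<Longrightarrow> y \<in> W \<Longrightarrow> (a, y) \<in> E \<Longrightarrow> y \<in> B"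
  proof -
    obtain X where X: "X \<subset> W" "X \<noteq> {}" "\<And>a y. a \<in> X \<Longrightarrow> y \<in> W \<Longrightarrow> (a, y) \<in> E \<Longrightarrow> y \<in> X"
      using S unfolding linked_def E_def W_def by blast
    show ?thesis
    proof (cases "x \<in> X")
      case True
      then show ?thesis using X that by blast
    next
      case False
      then show ?thesis using X x that[of "W - X"] symD unfolding W_def by blast
    qed
  qed
  \<comment> \<open>The component of \<open>x\<close> in the graph induced on
    \<open>W\<close>.\<close>
  define A where "A = {w. (x, w) \<in> (Restr E W)\<^sup>*}"
  have AB: "w \<in> B" if "w \<in> A" for w
    using that unfolding A_def mem_Collect_eq
    by (induction rule: rtrancl_induct) (use B in auto)
  have closed: "y \<in> A" if "a \<in> A" "y \<in> W" "(a, y) \<in> E" for a y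
  proof -
    have "(a, y) \<in> Restr E W" using that AB B by auto
    then show ?thesis using that unfolding A_def by (auto intro: rtrancl_into_rtrancl)
  qed
  have "x \<in> A" by (simp add: A_def)
  have fin: "finite S" using S by (auto intro: finite_subset)
  \<comment> \<open>By minimality of \<open>S\<close>, putting \<open>s\<close> back makes
    \<open>W\<close> connected.\<close>
  have "card (S - {s}) < card S" using s fin by (metis card_Diff1_less)
  then have "\<not> vertex_cut G (S - {s})"
    using connectivity_le[of G "S - {s}"] pair_graph_sym[OF pg] min by auto
  moreover have "pverts G - (S - {s}) = insert s W" using s S by (auto simp: W_def)
  ultimately have link: "linked E (insert s W)"
    using S by (auto simp: vertex_cut_def E_def)
  have "s \<notin> W" using s by (simp add: W_def)
  have AW: "A \<subset> W" using AB B by auto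
  \<comment> \<open>No arc joins \<open>A\<close> to the rest of \<open>W\<close>, so an arc leaving
    \<open>A\<close> inside \<open>insert s W\<close> ends in \<open>s\<close>. The same applies to
    \<open>W - A\<close> below.\<close>
  obtain a where a: "a \<in> A" "(a, s) \<in> E"
  proof -
    have "A \<subseteq> insert s W" "s \<in> insert s W" "s \<notin> A" using AW \<open>s \<notin> W\<close> by auto
    then obtain a y where "a \<in> A" "y \<in> insert s W" "y \<notin> A" "(a, y) \<in> E"
      using linkedD[OF link _ \<open>x \<in> A\<close>] by metis
    then show ?thesis using closed that by auto
  qed
  obtain b where b: "b \<in> W - A" "(b, s) \<in> E"
  proof -
    obtain w where "w \<in> W - A" using AW by auto
    moreover have "W - A \<subseteq> insert s W" "s \<in> insert s W" "s \<notin> W - A" using \<open>s \<notin> W\<close> by auto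
    ultimately obtain b y where bE: "b \<in> W - A" "y \<in> insert s W" "y \<notin> W - A" "(b, y) \<in> E"
      using linkedD[OF link] by metis
    moreover have "y \<notin> A" using bE closed[of y b] symD by auto
    ultimately show ?thesis using that by auto
  qed
  \<comment> \<open>Otherwise being a non-neighbour of \<open>s\<close> would spread along arcs from
    \<open>x\<close> to all of \<open>A\<close>, including \<open>a\<close>.\<close>
  obtain p q where pq: "p \<in> A" "q \<in> A" "(p, q) \<in> E" "(s, p) \<notin> E" "(s, q) \<in> E"
  proof (rule ccontr)
    assume no: "\<not> thesis"
    have "(s, a) \<notin> E" using a(1) unfolding A_def mem_Collect_eq
    proof (induction rule: rtrancl_induct)
      case base
      then show ?case using sx by (simp add: E_def)
    next
      case (step y z)
      then have "y \<in> A" "z \<in> A" unfolding A_def by (auto intro: rtrancl_into_rtrancl)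
      then show ?case using step that no by auto
    qed
    then show False using a symD by blast
  qed
  show False
  proof (rule cograph_P4_free[OF G, of p q s b])
    show "(p, q) \<in> parcs G" "(q, s) \<in> parcs G" "(s, b) \<in> parcs G" "(p, s) \<notin> parcs G"
      using pq b symD unfolding E_def by blast+
    show "(q, b) \<notin> parcs G" "(p, b) \<notin> parcs G"
      using pq b closed unfolding E_def by blast+
  qed
qed

section \<open>Deleting edges off a complete cut\<close>

text \<open>\<open>S\<close> remains a cut, as deletion cannot join what is separated. A smaller cut
  \<open>X\<close> spares some \<open>s\<close> in \<open>S\<close>: if it swallows
  \<open>W\<close>, no deleted arc survived anyway; if not, the intact join of \<open>S\<close> and
  \<open>W\<close> connects all remaining vertices.\<close>

lemma connectivity_del_edges_across_cut:
  assumes G: "pair_graph G" and S: "S \<subset> pverts G" "\<not> linked (parcs G) (pverts G - S)"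
    and min: "card S = connectivity G"
    and complete: "S \<times> (pverts G - S) \<subseteq> parcs G"
    and F: "sym F" "F \<subseteq> (pverts G - S) \<times> (pverts G - S)"
  shows "connectivity (del_edges G F) = connectivity G"
proof -
  interpret pair_graph G by (fact G)
  define V E W where "V = pverts G" and "E = parcs G" and "W = pverts G - S"
  note defs = V_def E_def W_def
  have sym: "sym E" unfolding E_def using G by (rule pair_graph_sym)
  have sym': "sym (E - F)" using sym F(1) by (auto simp: sym_def)
  have del [simp]: "pverts (del_edges G F) = V" "parcs (del_edges G F) = E - F"
    by (simp_all add: del_edges_def defs)
  have "vertex_cut (del_edges G F) S"
    using S unfolding vertex_cut_def linked_def del defs by blast
  then have "connectivity (del_edges G F) \<le> connectivity G"
    using connectivity_le[of "del_edges G F" S] sym' min by simp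
  moreover have "connectivity G \<le> connectivity (del_edges G F)"
  proof (rule ccontr)
    assume "\<not> ?thesis"
    moreover obtain X where X: "vertex_cut (del_edges G F) X" "card X = connectivity (del_edges G F)"
      using obtain_minimum_vertex_cut[of "del_edges G F"] sym' S by (auto simp: V_def)
    ultimately have less: "card X < card S" using min by simp
    then have noG: "\<not> vertex_cut G X" using connectivity_le[of G X] sym min by (auto simp: E_def)
    have XV: "X \<subset> V" using X by (simp add: vertex_cut_def)
    then have "finite X" by (auto simp: V_def intro: finite_subset)
    then obtain s where s: "s \<in> S" "s \<notin> X" using less by (meson card_mono leD subsetI)
    \<comment> \<open>If \<open>X\<close> left a single vertex, it would be a cut of
      \<open>G\<close> too; so \<open>X\<close> disconnects the graph after the deletion
      only.\<close>
    have nl: "\<not> linked (E - F) (V - X)" "linked E (V - X)"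
      using X noG unfolding vertex_cut_def del by (auto simp: defs)
    show False
    proof (cases "W \<subseteq> X")
      case True
      then have FX: "(x, y) \<notin> F" if "x \<in> V - X" for x y
        using that F(2) by (auto simp: defs)
      have "linked (E - F) (V - X)"
        unfolding linked_def
      proof (intro conjI allI impI)
        fix Y assume Y: "Y \<subset> V - X" "Y \<noteq> {}"
        then obtain p q where "p \<in> Y" "q \<in> V - X" "q \<notin> Y" by auto
        then obtain x y where "x \<in> Y" "y \<in> V - X" "y \<notin> Y" "(x, y) \<in> E"
          using linkedD[OF nl(2), of Y] Y(1) by (metis psubset_imp_subset)
        then show "\<exists>x\<in>Y. \<exists>y\<in>V - X - Y. (x, y) \<in> E - F" using FX Y(1) by blast
      qed (use XV in auto)
      then show False using nl by simp
    next
      case False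
      then obtain w where w: "w \<in> W" "w \<notin> X" by auto
      have edge: "(c, d) \<in> E - F \<and> (d, c) \<in> E - F" if "c \<in> S" "d \<in> W" for c d
        using that complete F(2) symD[OF sym] unfolding defs by blast
      have VSW: "V = S \<union> W" using S by (auto simp: defs)
      have "\<exists>x\<in>Y. \<exists>y\<in>V - X - Y. (x, y) \<in> E - F" if Y: "Y \<subset> V - X" "Y \<noteq> {}" for Y
      proof (rule ccontr)
        assume no: "\<not> ?thesis"
        \<comment> \<open>A set without leaving arcs contains both ends of a join edge or neither.
          Through \<open>s\<close> and \<open>w\<close> every remaining vertex then agrees with
          \<open>s\<close>, so \<open>Y\<close> would be empty or everything.\<close>
        have "c \<in> Y \<longleftrightarrow> d \<in> Y" if "c \<in> S - X" "d \<in> W - X" for c d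
          using no edge[of c d] that VSW by auto
        then have "c \<in> Y \<longleftrightarrow> s \<in> Y" if "c \<in> V - X" for c
          using that s w VSW by blast
        then show False using Y by blast
      qed
      then have "linked (E - F) (V - X)"
        unfolding linked_def using XV by blast
      then show False using nl by simp
    qed
  qed
  ultimately show ?thesis by simp
qed

section \<open>Degree counts and the two disjoint trees\<close>

lemma min_degree_le:
  assumes "pair_graph G" "v \<in> pverts G"
  shows "min_degree G \<le> card {y \<in> pverts G. (v, y) \<in> parcs G}"
proof -
  interpret pair_graph G by fact
  have "out_arcs (with_proj G) v = Pair v ` {y \<in> pverts G. (v, y) \<in> parcs G}"
    by (auto simp: out_arcs_def intro: in_arcsD2)
  then have "out_degree (with_proj G) v = card {y \<in> pverts G. (v, y) \<in> parcs G}"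
    by (simp add: out_degree_def card_image inj_on_def)
  then show ?thesis
    unfolding min_degree_def using assms(2) by (metis Min_le finite_imageI imageI pair_finite_verts)
qed

lemma subtree_pair_graph: "subtree T G \<Longrightarrow> pair_graph T"
  by (simp add: subtree_def graph_tree_def)

lemma pair_graph_parcs_subset: "pair_graph T \<Longrightarrow> parcs T \<subseteq> pverts T \<times> pverts T"
proof -
  assume "pair_graph T"
  then interpret pair_graph T .
  show ?thesis by (auto intro: in_arcsD1 in_arcsD2)
qed

theorem theorem11:
  fixes G :: "'a pair_pre_digraph"
    and T1 :: "'b pair_pre_digraph"
    and T2 :: "'c pair_pre_digraph"
    and m :: nat
  assumes "graph_tree T1" and "card (pverts T1) = m"
    and "graph_tree T2" and "card (pverts T2) = m"
    and "cograph G" and "connected (with_proj G)"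
    and "2 \<le> card (pverts G)"
    and "min_degree G \<ge> connectivity G + m - 1"
  shows "\<exists>T1' T2'. subtree T1' G \<and> digraph_iso (with_proj T1') (with_proj T1)
    \<and> subtree T2' G \<and> digraph_iso (with_proj T2') (with_proj T2)
    \<and> pverts T1' \<inter> pverts T2' = {}
    \<and> connectivity (del_edges G (parcs T1' \<union> parcs T2')) = connectivity G"
proof -
  have pg: "pair_graph G" using assms(5) by (rule cograph_imp_pair_graph)
  interpret pair_graph G by (fact pg)
  let ?V = "pverts G"
  let ?N = "\<lambda>C x. {y \<in> C. (x, y) \<in> parcs G}"
  note sym = pair_graph_sym[OF pg]
  have "?V \<noteq> {}" using assms(7) by auto
  then obtain S where S: "vertex_cut G S" "card S = connectivity G"
    using obtain_minimum_vertex_cut[OF sym] by blast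
  have deg: "connectivity G + m - 1 \<le> card (?N ?V x)" if "x \<in> ?V" for x
    using min_degree_le[OF pg that] assms(8) by simp
  have SV: "S \<subset> ?V" using S by (simp add: vertex_cut_def)
  then have "finite S" by (auto intro: finite_subset)
  show ?thesis
  proof (cases "linked (parcs G) (?V - S)")
    case True
    then have "card (?V - S) = 1" using S by (simp add: vertex_cut_def)
    \<comment> \<open>Here the connectivity is the order minus 1, an upper bound for every degree,
      which leaves room only for \<open>m \<le> 1\<close>.\<close>
    then have cS: "card S = card ?V - 1"
      using SV \<open>finite S\<close> card_Diff_subset[of S ?V] card_mono[OF pair_finite_verts, of S] by auto
    have "\<not> card ?V \<le> 1" using assms(7) by simp
    then obtain u v where uv: "u \<in> ?V" "v \<in> ?V" "u \<noteq> v"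
      by (metis card_le_Suc0_iff_eq One_nat_def pair_finite_verts)
    have "?N ?V u \<subseteq> ?V - {u}" using no_loops' by auto
    then have "card (?N ?V u) \<le> card ?V - 1"
      using uv card_mono[of "?V - {u}" "?N ?V u"] by (simp add: card_Diff_singleton)
    then have "m \<le> 1" using deg[OF uv(1)] cS S(2) by simp
    \<comment> \<open>For trees of order at most 1 the degree bound is trivial, so distinct single
      vertices \<open>u\<close> and \<open>v\<close> can be the hosts.\<close>
    then have small: "card (pverts T1) \<le> Suc n" "card (pverts T2) \<le> Suc n" for n
      using assms(2,4) by auto
    obtain T1' T2' where T:
      "subtree T1' G" "digraph_iso (with_proj T1') (with_proj T1)" "pverts T1' \<subseteq> {u}"
      "subtree T2' G" "digraph_iso (with_proj T2') (with_proj T2)" "pverts T2' \<subseteq> {v}"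
      using subtree_within[OF assms(1) pg _ _ small(1), of "{u}"]
        subtree_within[OF assms(3) pg _ _ small(2), of "{v}"] uv
      by (metis empty_subsetI insert_not_empty insert_subset)
    have no_arcs: "parcs T' = {}" if "subtree T' G" "pverts T' \<subseteq> {w}" for T' w
    proof -
      interpret T': pair_graph T' using that(1) by (rule subtree_pair_graph)
      have "(a, b) \<notin> parcs T'" for a b
        using that(2) T'.no_loops'[of a b] T'.in_arcsD1[of a b] T'.in_arcsD2[of a b] by blast
      then show ?thesis by auto
    qed
    have "del_edges G (parcs T1' \<union> parcs T2') = G"
      using no_arcs[OF T(1,3)] no_arcs[OF T(4,6)] by (simp add: del_edges_def)
    then show ?thesis using T uv(3) by (intro exI[of _ T1'] exI[of _ T2']) auto
  next
    case False
    define W where "W = ?V - S"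
    have "W \<noteq> {}" using SV by (auto simp: W_def)
    then obtain B where B: "B \<subset> W" "B \<noteq> {}"
      "\<And>a y. a \<in> B \<Longrightarrow> y \<in> W - B \<Longrightarrow> (a, y) \<notin> parcs G"
      using False unfolding linked_def W_def by blast
    \<comment> \<open>A vertex of \<open>C\<close> has all its neighbours in \<open>S\<close> or
      \<open>C\<close>; at most \<open>connectivity G\<close> of them lie in \<open>S\<close>, so
      \<open>m - 1\<close> remain in \<open>C\<close>.\<close>
    have deg': "m \<le> Suc (card (?N C x))"
      if C: "C \<subseteq> W" "x \<in> C" "\<And>y. y \<in> W - C \<Longrightarrow> (x, y) \<notin> parcs G" for C x
    proof -
      have "finite C" using C by (auto simp: W_def intro: finite_subset)
      have "?N ?V x \<subseteq> S \<union> ?N C x" using C by (auto simp: W_def)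
      then have "card (?N ?V x) \<le> card (S \<union> ?N C x)"
        using \<open>finite S\<close> \<open>finite C\<close> by (intro card_mono) auto
      also have "\<dots> \<le> connectivity G + card (?N C x)"
        using card_Un_le[of S] S(2) by simp
      finally show ?thesis using deg[of x] C by (auto simp: W_def)
    qed
    have "B \<subseteq> ?V" "W - B \<subseteq> ?V" "W - B \<noteq> {}" using B by (auto simp: W_def)
    moreover have "m \<le> Suc (card (?N B x))" if "x \<in> B" for x
      using that B by (intro deg') auto
    moreover have "m \<le> Suc (card (?N (W - B) x))" if "x \<in> W - B" for x
      using that B symD[OF sym] by (intro deg') auto
    ultimately obtain T1' T2' where T:
      "subtree T1' G" "digraph_iso (with_proj T1') (with_proj T1)" "pverts T1' \<subseteq> B"
      "subtree T2' G" "digraph_iso (with_proj T2') (with_proj T2)" "pverts T2' \<subseteq> W - B"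
      using subtree_within[OF assms(1) pg, of B] subtree_within[OF assms(3) pg, of "W - B"]
        B(2) assms(2,4) by metis
    note pgT = subtree_pair_graph[OF T(1)] subtree_pair_graph[OF T(4)]
    have "connectivity (del_edges G (parcs T1' \<union> parcs T2')) = connectivity G"
    \<comment> \<open>The trees lie in \<open>B\<close> and \<open>W - B\<close>, so all deleted
      arcs stay inside \<open>W\<close> and spare the join with \<open>S\<close>.\<close>
    proof (rule connectivity_del_edges_across_cut[OF pg SV False S(2)])
      show "S \<times> (?V - S) \<subseteq> parcs G"
        using cograph_minimum_cut_complete[OF assms(5) SV False S(2)] by auto
      show "sym (parcs T1' \<union> parcs T2')" using pgT by (intro sym_Un pair_graph_sym)
      show "parcs T1' \<union> parcs T2' \<subseteq> (?V - S) \<times> (?V - S)"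
        using pgT[THEN pair_graph_parcs_subset] T(3,6) B(1) unfolding W_def by blast
    qed
    then show ?thesis using T by (intro exI[of _ T1'] exI[of _ T2']) auto
  qed
qed

end
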